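(* Let $p^{+}$ be an upper-tail $p$-value function for the scalar interest parameter $\theta\in\Theta$, with associated lower-tail $p$-value function $p^{-}=1-p^{+}$. Assume that all one-sided tests represented by $p^{\pm}$ are asymptotically powerful, in the sense that for every $\alpha\in(0,1)$, every $\gamma\in\Gamma$ and all $\theta,\theta'\in\Theta$, $$\theta>\theta'\implies \lim_{n\to\infty}P_{\theta,\gamma}\left(p_X^{+}(\theta')>\alpha\right)=0,\qquad \theta<\theta'\implies \lim_{n\to\infty}P_{\theta,\gamma}\left(p_X^{-}(\theta')>\alpha\right)=0.$$ Let $\hat 1:\mathcal{A}\times\Omega\to[0,1]$, written $(\Theta',x)\mapsto \hat 1_{\Theta'}(x)$, be such that for every $x\in\Omega$ the set function $P^x=\hat 1_{\bullet}(x)$ is the confidence measure corresponding to $p^{\pm}$ given $X=x$. Then $\hat 1$ is a consistent indicator estimator; that is, for every $\Theta'\in\mathcal{A}$, every $\gamma\in\Gamma$, and every $\theta\in\Theta$ that is not an element of the boundary of $\Theta'$, $$\hat 1_{\Theta'}(X)=P^{X}(\Theta')\longrightarrow 1_{\Theta'}(\theta)\quad\text{in } P_{\theta,\gamma}\text{-probability as } n\to\infty .$$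
   Context: Setting. For each sample size $n$, the data $X$ is a random quantity with realizations $x$ in a sample set $\Omega\subseteq\mathbb{R}^n$ and distribution $P_\xi=P_{\theta,\gamma}$, where the full parameter is $\xi=\langle\theta,\gamma\rangle\in\Theta\times\Gamma$, $\theta\in\Theta$ is a scalar interest parameter and $\gamma\in\Gamma$ is a nuisance parameter. All of $\Omega$, $X$, $P_{\theta,\gamma}$, $p^{\pm}$, $P^x$ and $\hat 1$ depend on $n$, while $\Theta$, $\mathcal{A}$ and $\Gamma$ do not; the dependence on $n$ is suppressed in the notation, and limits are as $n\to\infty$. Here $\Theta\subseteq\mathbb{R}$ is a (nondegenerate) interval and $\mathcal{A}$ is the Borel $\sigma$-field of $\Theta$. All functions of $X$ are taken to be measurable. Upper- and lower-tail $p$-value functions. An upper-tail $p$-value function for $\theta$ is a function $p^{+}:\Omega\times\Theta\to[0,1]$, $p^{+}(x,\theta')=p_x^{+}(\theta')$, such that for every $x\in\Omega$ the map $p_x^{+}$ is a cumulative distribution function (of a probability measure on $\Theta$), and such that $P_{\theta,\gamma}\left(p_X^{+}(\theta)<\alpha\right)=\alpha$ for all $\theta\in\Theta$, $\gamma\in\Gamma$, $\alpha\in[0,1]$. The lower-tail $p$-value function is $p_x^{-}(\theta')=1-p_x^{+}(\theta')$. Confidence measure corresponding to $p^{\pm}$. Given $X=x$, it is the probability measure $P^x$ on $(\Theta,\mathcal{A})$ whose cumulative distribution function is $p_x^{+}$, i.e. $P^x\left(\{\vartheta\in\Theta:\vartheta\le\theta'\}\right)=p_x^{+}(\theta')$ for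 all $\theta'\in\Theta$. Consistent indicator estimator. A map $\hat 1$ assigning to each $\Theta'\in\mathcal{A}$ and $x\in\Omega$ a number $\hat 1_{\Theta'}(x)$ is called consistent if, for all $\Theta'\in\mathcal{A}$, $\hat 1_{\Theta'}(X)\to 1_{\Theta'}(\theta)$ in $P_{\theta,\gamma}$-probability for every $\gamma\in\Gamma$ and every $\theta\in\Theta$ not in the boundary of $\Theta'$. Here $1_{\Theta'}(\theta)$ is $1$ if $\theta\in\Theta'$ and $0$ otherwise, and the boundary of $\Theta'$ is its closure minus its interior. *)

theory Defs
  imports "HOL-Probability.Probability"
begin

text \<open>
  Points of \<open>\<real>\<^sup>n\<close> are the extensional functions on \<open>{..<n}\<close>, so that the sample size may vary inside
  one statement; the sample set carries the trace of the Borel \<open>\<sigma>\<close>-field. Sample sizes are the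
  \<open>n \<ge> 1\<close> throughout: on the one-point space \<open>\<real>\<^sup>0\<close> no \<open>p\<close>-value can be uniformly distributed, so
  admitting \<open>n = 0\<close> would make the hypotheses contradictory.
\<close>

definition sample_space :: "(nat \<Rightarrow> (nat \<Rightarrow> real) set) \<Rightarrow> nat \<Rightarrow> (nat \<Rightarrow> real) measure" where
  "sample_space \<Omega> n = restrict_space (Pi\<^sub>M {..<n} (\<lambda>_. borel)) (\<Omega> n)"

locale statistical_model =
  fixes \<Omega> :: "nat \<Rightarrow> (nat \<Rightarrow> real) set"
    and \<Theta> :: "real set"
    and \<Gamma> :: "'g set"
    and P :: "nat \<Rightarrow> real \<Rightarrow> 'g \<Rightarrow> (nat \<Rightarrow> real) measure"
  assumes interval: "is_interval \<Theta>"
    and nondegenerate: "\<exists>a\<in>\<Theta>. \<exists>b\<in>\<Theta>. a < b"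
    and sample_set: "n \<ge> 1 \<Longrightarrow> \<Omega> n \<subseteq> space (Pi\<^sub>M {..<n} (\<lambda>_. borel))"
    and prob_space_P: "n \<ge> 1 \<Longrightarrow> \<theta> \<in> \<Theta> \<Longrightarrow> \<gamma> \<in> \<Gamma> \<Longrightarrow> prob_space (P n \<theta> \<gamma>)"
    and sets_P: "n \<ge> 1 \<Longrightarrow> \<theta> \<in> \<Theta> \<Longrightarrow> \<gamma> \<in> \<Gamma> \<Longrightarrow> sets (P n \<theta> \<gamma>) = sets (sample_space \<Omega> n)"

text \<open>
  \<open>Q\<close> is a probability measure on the Borel \<open>\<sigma>\<close>-field of \<open>\<Theta>\<close> with cumulative distribution function
  \<open>F\<close>. Only the values of \<open>F\<close> on \<open>\<Theta>\<close> matter, and they lie in \<open>[0,1]\<close> automatically.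
\<close>

definition prob_measure_with_cdf :: "real set \<Rightarrow> real measure \<Rightarrow> (real \<Rightarrow> real) \<Rightarrow> bool" where
  "prob_measure_with_cdf \<Theta> Q F \<longleftrightarrow>
     prob_space Q \<and> sets Q = sets (restrict_space borel \<Theta>) \<and>
     (\<forall>t\<in>\<Theta>. measure Q {v\<in>\<Theta>. v \<le> t} = F t)"

definition upper_tail_p_value_function ::
  "(nat \<Rightarrow> (nat \<Rightarrow> real) set) \<Rightarrow> real set \<Rightarrow> 'g set \<Rightarrow> (nat \<Rightarrow> real \<Rightarrow> 'g \<Rightarrow> (nat \<Rightarrow> real) measure)
    \<Rightarrow> (nat \<Rightarrow> (nat \<Rightarrow> real) \<Rightarrow> real \<Rightarrow> real) \<Rightarrow> bool" where
  "upper_tail_p_value_function \<Omega> \<Theta> \<Gamma> P p \<longleftrightarrow>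
     (\<forall>n\<ge>1.
       (\<forall>t\<in>\<Theta>. (\<lambda>x. p n x t) \<in> borel_measurable (sample_space \<Omega> n)) \<and>
       (\<forall>x\<in>\<Omega> n. \<exists>Q. prob_measure_with_cdf \<Theta> Q (p n x)) \<and>
       (\<forall>\<theta>\<in>\<Theta>. \<forall>\<gamma>\<in>\<Gamma>. \<forall>\<alpha>\<in>{0..1}. \<P>(x in P n \<theta> \<gamma>. p n x \<theta> < \<alpha>) = \<alpha>))"

definition lower_tail ::
  "(nat \<Rightarrow> (nat \<Rightarrow> real) \<Rightarrow> real \<Rightarrow> real) \<Rightarrow> nat \<Rightarrow> (nat \<Rightarrow> real) \<Rightarrow> real \<Rightarrow> real" where
  "lower_tail p n x t = 1 - p n x t"

definition asymptotically_powerful ::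
  "real set \<Rightarrow> 'g set \<Rightarrow> (nat \<Rightarrow> real \<Rightarrow> 'g \<Rightarrow> (nat \<Rightarrow> real) measure)
    \<Rightarrow> (nat \<Rightarrow> (nat \<Rightarrow> real) \<Rightarrow> real \<Rightarrow> real) \<Rightarrow> bool" where
  "asymptotically_powerful \<Theta> \<Gamma> P p \<longleftrightarrow>
     (\<forall>\<alpha>\<in>{0<..<1}. \<forall>\<gamma>\<in>\<Gamma>. \<forall>\<theta>\<in>\<Theta>. \<forall>\<theta>'\<in>\<Theta>.
       (\<theta> > \<theta>' \<longrightarrow> (\<lambda>n. \<P>(x in P n \<theta> \<gamma>. p n x \<theta>' > \<alpha>)) \<longlonglongrightarrow> 0) \<and>
       (\<theta> < \<theta>' \<longrightarrow> (\<lambda>n. \<P>(x in P n \<theta> \<gamma>. lower_tail p n x \<theta>' > \<alpha>)) \<longlonglongrightarrow> 0))"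

definition is_confidence_measure ::
  "real set \<Rightarrow> (real \<Rightarrow> real) \<Rightarrow> (real set \<Rightarrow> real) \<Rightarrow> bool" where
  "is_confidence_measure \<Theta> F C \<longleftrightarrow>
     (\<exists>Q. prob_measure_with_cdf \<Theta> Q F \<and> (\<forall>A\<in>sets (restrict_space borel \<Theta>). C A = measure Q A))"

text \<open>The underlying probability space is allowed to change with \<open>n\<close>.\<close>

definition tendsto_in_probability ::
  "(nat \<Rightarrow> 'x measure) \<Rightarrow> (nat \<Rightarrow> 'x \<Rightarrow> real) \<Rightarrow> real \<Rightarrow> bool" where
  "tendsto_in_probability M Y c \<longleftrightarrow>
     (\<forall>\<epsilon>>0. (\<lambda>n. \<P>(x in M n. \<bar>Y n x - c\<bar> > \<epsilon>)) \<longlonglongrightarrow> 0)"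

text \<open>
  The first clause records that an estimator is a measurable function of the data. The boundary is
  taken in the subspace topology of the parameter space \<open>\<Theta>\<close>; it is contained in the boundary taken
  in \<open>\<real>\<close>, so this is the more demanding of the two readings.
\<close>

definition consistent_indicator_estimator ::
  "(nat \<Rightarrow> (nat \<Rightarrow> real) set) \<Rightarrow> real set \<Rightarrow> 'g set \<Rightarrow> (nat \<Rightarrow> real \<Rightarrow> 'g \<Rightarrow> (nat \<Rightarrow> real) measure)
    \<Rightarrow> (nat \<Rightarrow> real set \<Rightarrow> (nat \<Rightarrow> real) \<Rightarrow> real) \<Rightarrow> bool" where
  "consistent_indicator_estimator \<Omega> \<Theta> \<Gamma> P I \<longleftrightarrow>
     (\<forall>A\<in>sets (restrict_space borel \<Theta>).
       (\<forall>n\<ge>1. I n A \<in> borel_measurable (sample_space \<Omega> n)) \<and>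
       (\<forall>\<gamma>\<in>\<Gamma>. \<forall>\<theta>\<in>\<Theta>. \<theta> \<notin> top_of_set \<Theta> frontier_of A \<longrightarrow>
         tendsto_in_probability (\<lambda>n. P n \<theta> \<gamma>) (\<lambda>n. I n A) (indicator A \<theta>)))"

end

theory Submission
  imports Defs
begin

text \<open>
  Away from a neighbourhood of \<open>\<theta>\<close> the confidence measure is dominated by the mass of the two tails
  \<open>{v. v \<le> a}\<close> and \<open>{v. v > b}\<close> with \<open>a < \<theta> < b\<close>, that is by \<open>p\<^sup>+(a) + p\<^sup>-(b)\<close>, and each of these
  tends to \<open>0\<close> in probability because the one-sided tests are asymptotically powerful. If \<open>\<theta>\<close> is not
  in the boundary of \<open>A\<close>, either \<open>A\<close> or its complement misses a neighbourhood of \<open>\<theta>\<close>.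
\<close>

section \<open>Generators of the Borel \<sigma>-field of an interval\<close>

text \<open>All points of an interval lie on the same side of any \<open>t\<close> outside it, so a
  ray with such an endpoint has trace \<open>{}\<close> or \<open>\<Theta>\<close>. Hence endpoints
  in \<open>\<Theta>\<close> suffice, and these are the only ones at which the distribution function
  is prescribed.\<close>

lemma sets_restrict_borel_eq_sigma_sets_atMost:
  fixes \<Theta> :: "real set"
  assumes "is_interval \<Theta>"
  shows "sets (restrict_space borel \<Theta>) = sigma_sets \<Theta> (insert \<Theta> ((\<lambda>t. {v\<in>\<Theta>. v \<le> t}) ` \<Theta>))"
    (is "_ = sigma_sets \<Theta> ?G")
proof
  have below: "{v\<in>\<Theta>. v \<le> t} \<in> sigma_sets \<Theta> ?G" for t
  proof (cases "t \<in> \<Theta>")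
    case False
    with assms have "{v\<in>\<Theta>. v \<le> t} = {} \<or> {v\<in>\<Theta>. v \<le> t} = \<Theta>"
      unfolding is_interval_1 by fastforce
    then show ?thesis
      using sigma_sets.Empty sigma_sets_top by metis
  qed auto
  \<comment> \<open>Presenting \<open>borel\<close> by its rays makes every Borel set accessible to
    induction over \<open>sigma_sets\<close>; taking traces on \<open>\<Theta>\<close> commutes with
    complements and countable unions.\<close>
  have "restrict_space borel \<Theta> = restrict_space (sigma UNIV (range atMost)) \<Theta>"
    by (simp only: borel_eq_atMost)
  then have "sets (restrict_space borel \<Theta>) = (\<inter>) \<Theta> ` sigma_sets UNIV (range atMost)"
    by (simp add: sets_restrict_space)
  also have "\<dots> \<subseteq> sigma_sets \<Theta> ?G"
  proof (rule image_subsetI)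
    fix B :: "real set" assume "B \<in> sigma_sets UNIV (range atMost)"
    then show "\<Theta> \<inter> B \<in> sigma_sets \<Theta> ?G"
    proof induction
      case (Basic B)
      then obtain t where "B = {..t}" by auto
      then have "\<Theta> \<inter> B = {v\<in>\<Theta>. v \<le> t}" by auto
      then show ?case using below by simp
    next
      case Empty
      then show ?case by (simp add: sigma_sets.Empty)
    next
      case (Compl B)
      have "\<Theta> \<inter> (UNIV - B) = \<Theta> - \<Theta> \<inter> B" by auto
      then show ?case using Compl sigma_sets.Compl by metis
    next
      case (Union B)
      show ?case
        unfolding Int_UN_distrib by (rule sigma_sets.Union) (rule Union)
    qed
  qed
  finally show "sets (restrict_space borel \<Theta>) \<subseteq> sigma_sets \<Theta> ?G" .
  have "\<Theta> \<inter> UNIV \<in> (\<inter>) \<Theta> ` sets borel" "\<Theta> \<inter> {..t} \<in> (\<inter>) \<Theta> ` sets borel" for t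
    by (intro imageI; simp)+
  moreover have "{v\<in>\<Theta>. v \<le> t} = \<Theta> \<inter> {..t}" for t
    by blast
  ultimately have "?G \<subseteq> sets (restrict_space borel \<Theta>)"
    unfolding sets_restrict_space by auto
  then show "sigma_sets \<Theta> ?G \<subseteq> sets (restrict_space borel \<Theta>)"
    using sets.sigma_sets_subset[of ?G "restrict_space borel \<Theta>"] by (simp add: space_restrict_space)
qed

section \<open>The confidence measure and its measurability in the data\<close>

locale confidence_model = statistical_model \<Omega> \<Theta> \<Gamma> P
  for \<Omega> :: "nat \<Rightarrow> (nat \<Rightarrow> real) set"
    and \<Theta> :: "real set"
    and \<Gamma> :: "'g set"
    and P :: "nat \<Rightarrow> real \<Rightarrow> 'g \<Rightarrow> (nat \<Rightarrow> real) measure" +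
  fixes p :: "nat \<Rightarrow> (nat \<Rightarrow> real) \<Rightarrow> real \<Rightarrow> real"
    and I :: "nat \<Rightarrow> real set \<Rightarrow> (nat \<Rightarrow> real) \<Rightarrow> real"
  assumes p_value: "upper_tail_p_value_function \<Omega> \<Theta> \<Gamma> P p"
    and powerful: "asymptotically_powerful \<Theta> \<Gamma> P p"
    and confidence: "n \<ge> 1 \<Longrightarrow> x \<in> \<Omega> n \<Longrightarrow> is_confidence_measure \<Theta> (p n x) (\<lambda>A. I n A x)"
begin

abbreviation "\<A> \<equiv> sets (restrict_space borel \<Theta>)"

lemma space_sample_space: "n \<ge> 1 \<Longrightarrow> space (sample_space \<Omega> n) = \<Omega> n"
  unfolding sample_space_def space_restrict_space by (rule Int_absorb2[OF sample_set])

lemma space_P: "n \<ge> 1 \<Longrightarrow> \<theta> \<in> \<Theta> \<Longrightarrow> \<gamma> \<in> \<Gamma> \<Longrightarrow> space (P n \<theta> \<gamma>) = \<Omega> n"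
  by (simp add: sets_eq_imp_space_eq[OF sets_P] space_sample_space)

text \<open>The estimator \<open>I\<close> is only a real-valued function of sets and data. The
  measure recovered here, with its space identified as \<open>\<Theta>\<close>, is the source of
  every algebraic property of \<open>I\<close> used later.\<close>

lemma confidence_measure:
  assumes "n \<ge> 1" "x \<in> \<Omega> n"
  obtains Q where "prob_space Q" "sets Q = \<A>" "space Q = \<Theta>"
    and "\<And>t. t \<in> \<Theta> \<Longrightarrow> measure Q {v\<in>\<Theta>. v \<le> t} = p n x t"
    and "\<And>A. A \<in> \<A> \<Longrightarrow> I n A x = measure Q A"
proof -
  obtain Q where Q: "prob_measure_with_cdf \<Theta> Q (p n x)" "\<forall>A\<in>\<A>. I n A x = measure Q A"
    using confidence[OF assms] unfolding is_confidence_measure_def by blast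
  have sets_Q: "sets Q = \<A>"
    using Q(1) by (simp add: prob_measure_with_cdf_def)
  have "space Q = \<Theta>"
    using sets_eq_imp_space_eq[OF sets_Q] by (simp add: space_restrict_space)
  with Q sets_Q show ?thesis
    by (intro that[of Q]) (auto simp: prob_measure_with_cdf_def)
qed

text \<open>Measurability in \<open>x\<close> is assumed only for the values \<open>p n x t\<close>,
  which are the masses of rays. The rays together with \<open>\<Theta>\<close> form an
  intersection-stable generator, so the family of measures is a probability kernel, and evaluating a
  kernel at \<open>A\<close> is measurable.\<close>

lemma measurable_confidence:
  assumes n: "n \<ge> 1" and A: "A \<in> \<A>"
  shows "I n A \<in> borel_measurable (sample_space \<Omega> n)"
proof -
  let ?M = "sample_space \<Omega> n" and ?N = "restrict_space borel \<Theta>"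
  let ?G = "insert \<Theta> ((\<lambda>t. {v\<in>\<Theta>. v \<le> t}) ` \<Theta>)"
  have "\<forall>x\<in>\<Omega> n. \<exists>Q. prob_space Q \<and> sets Q = \<A> \<and> space Q = \<Theta> \<and>
      (\<forall>t\<in>\<Theta>. measure Q {v\<in>\<Theta>. v \<le> t} = p n x t) \<and> (\<forall>A\<in>\<A>. I n A x = measure Q A)"
  proof
    fix x assume "x \<in> \<Omega> n"
    from confidence_measure[OF n this] show "\<exists>Q. prob_space Q \<and> sets Q = \<A> \<and> space Q = \<Theta> \<and>
      (\<forall>t\<in>\<Theta>. measure Q {v\<in>\<Theta>. v \<le> t} = p n x t) \<and> (\<forall>A\<in>\<A>. I n A x = measure Q A)"
      by metis
  qed
  \<comment> \<open>The measure is chosen separately for each \<open>x\<close>, without regard to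
    measurability; that \<open>K\<close> is a kernel is established afterwards from its values on
    the generator.\<close>
  from bchoice[OF this] obtain K where K: "\<And>x. x \<in> \<Omega> n \<Longrightarrow> prob_space (K x)" "\<And>x. x \<in> \<Omega> n \<Longrightarrow> sets (K x) = \<A>"
      "\<And>x. x \<in> \<Omega> n \<Longrightarrow> space (K x) = \<Theta>"
      "\<And>x t. x \<in> \<Omega> n \<Longrightarrow> t \<in> \<Theta> \<Longrightarrow> measure (K x) {v\<in>\<Theta>. v \<le> t} = p n x t"
      "\<And>x A. x \<in> \<Omega> n \<Longrightarrow> A \<in> \<A> \<Longrightarrow> I n A x = measure (K x) A"
    by blast
  have p_measurable: "(\<lambda>x. p n x t) \<in> borel_measurable ?M" if "t \<in> \<Theta>" for t
    using p_value n that by (auto simp: upper_tail_p_value_function_def)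
  have "K \<in> measurable ?M (prob_algebra ?N)"
  proof (rule measurable_prob_algebra_generated)
    show "sets ?N = sigma_sets \<Theta> ?G"
      by (rule sets_restrict_borel_eq_sigma_sets_atMost[OF interval])
    show "Int_stable ?G"
    proof (rule Int_stableI)
      fix B C assume "B \<in> ?G" "C \<in> ?G"
      then consider "B = \<Theta>" "C \<subseteq> \<Theta>" | "C = \<Theta>" "B \<subseteq> \<Theta>" |
          s t where "s \<in> \<Theta>" "t \<in> \<Theta>" "B = {v\<in>\<Theta>. v \<le> s}" "C = {v\<in>\<Theta>. v \<le> t}"
        by blast
      then show "B \<inter> C \<in> ?G"
      proof cases
        case 3
        then have "B \<inter> C = {v\<in>\<Theta>. v \<le> min s t}" "min s t \<in> \<Theta>"
          by (auto simp: min_def)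
        then show ?thesis by blast
      qed (use \<open>B \<in> ?G\<close> \<open>C \<in> ?G\<close> in \<open>simp_all add: Int_absorb1 Int_absorb2\<close>)
    qed
    show "?G \<subseteq> Pow \<Theta>" by auto
    show "prob_space (K x)" if "x \<in> space ?M" for x
      using that K n space_sample_space by simp
    show "sets (K x) = sets ?N" if "x \<in> space ?M" for x
      using that K n space_sample_space by simp
    show "(\<lambda>x. emeasure (K x) B) \<in> borel_measurable ?M" if "B \<in> ?G" for B
    proof (cases "B = \<Theta>")
      case True
      have "emeasure (K x) B = 1" if "x \<in> space ?M" for x
        using that K n space_sample_space prob_space.emeasure_space_1[of "K x"] True by simp
      then show ?thesis
        by (simp cong: measurable_cong)
    next
      case False
      with that obtain t where t: "t \<in> \<Theta>" "B = {v\<in>\<Theta>. v \<le> t}" by auto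
      have "emeasure (K x) B = ennreal (p n x t)" if "x \<in> space ?M" for x
      proof -
        have "x \<in> \<Omega> n" using that n space_sample_space by simp
        then interpret prob_space "K x" by (rule K)
        show ?thesis
          using K(4)[OF \<open>x \<in> \<Omega> n\<close> t(1)] t(2) by (simp add: emeasure_eq_measure)
      qed
      then show ?thesis
        using p_measurable[OF t(1)] by (simp cong: measurable_cong)
    qed
  qed
  then have "(\<lambda>x. measure (K x) A) \<in> borel_measurable ?M"
    using A by (intro measurable_compose[OF measurable_prob_algebraD measurable_measure_subprob_algebra])
  moreover have "I n A x = measure (K x) A" if "x \<in> space ?M" for x
    using that K(5)[OF _ A] space_sample_space[OF n] by simp
  ultimately show ?thesis
    by (simp cong: measurable_cong)
qed

section \<open>Algebra of the confidence measure and its values on rays\<close>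

lemma confidence_mono:
  assumes "n \<ge> 1" "x \<in> \<Omega> n" "A \<in> \<A>" "B \<in> \<A>" "A \<subseteq> B"
  shows "I n A x \<le> I n B x"
proof -
  from confidence_measure[OF assms(1,2)] obtain Q where "prob_space Q" "sets Q = \<A>"
    "\<And>A. A \<in> \<A> \<Longrightarrow> I n A x = measure Q A" by metis
  with assms show ?thesis
    by (simp add: finite_measure.finite_measure_mono prob_space.finite_measure)
qed

lemma confidence_Un_le:
  assumes "n \<ge> 1" "x \<in> \<Omega> n" "A \<in> \<A>" "B \<in> \<A>"
  shows "I n (A \<union> B) x \<le> I n A x + I n B x"
proof -
  from confidence_measure[OF assms(1,2)] obtain Q where "prob_space Q" "sets Q = \<A>"
    "\<And>A. A \<in> \<A> \<Longrightarrow> I n A x = measure Q A" by metis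
  with assms show ?thesis
    by (simp add: measure_Un_le sets.Un)
qed

lemma confidence_nonneg:
  assumes "n \<ge> 1" "x \<in> \<Omega> n" "A \<in> \<A>"
  shows "0 \<le> I n A x"
proof -
  from confidence_measure[OF assms(1,2)] obtain Q where "\<And>A. A \<in> \<A> \<Longrightarrow> I n A x = measure Q A" by metis
  with assms(3) show ?thesis by simp
qed

lemma confidence_empty:
  assumes "n \<ge> 1" "x \<in> \<Omega> n"
  shows "I n {} x = 0"
proof -
  from confidence_measure[OF assms] obtain Q where "\<And>A. A \<in> \<A> \<Longrightarrow> I n A x = measure Q A" by metis
  from this[OF sets.empty_sets] show ?thesis by simp
qed

lemma confidence_compl:
  assumes "n \<ge> 1" "x \<in> \<Omega> n" "A \<in> \<A>"
  shows "I n (\<Theta> - A) x = 1 - I n A x"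
proof -
  from confidence_measure[OF assms(1,2)] obtain Q where Q: "prob_space Q" "sets Q = \<A>" "space Q = \<Theta>"
    "\<And>A. A \<in> \<A> \<Longrightarrow> I n A x = measure Q A" by metis
  then have "\<Theta> - A \<in> \<A>"
    using assms(3) by (metis sets.compl_sets)
  with Q assms(3) show ?thesis
    using prob_space.prob_compl[of Q A] by simp
qed

lemma atMost_sets: "{v\<in>\<Theta>. v \<le> t} \<in> \<A>"
proof -
  have "{v\<in>\<Theta>. v \<le> t} = \<Theta> \<inter> {..t}" by blast
  moreover have "\<Theta> \<inter> {..t} \<in> \<A>"
    unfolding sets_restrict_space by (rule imageI) simp
  ultimately show ?thesis by (simp only:)
qed

lemma atLeast_sets: "{v\<in>\<Theta>. v \<ge> t} \<in> \<A>"
proof -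
  have "{v\<in>\<Theta>. v \<ge> t} = \<Theta> \<inter> {t..}" by blast
  moreover have "\<Theta> \<inter> {t..} \<in> \<A>"
    unfolding sets_restrict_space by (rule imageI) simp
  ultimately show ?thesis by (simp only:)
qed

lemma confidence_atMost:
  assumes "n \<ge> 1" "x \<in> \<Omega> n" "t \<in> \<Theta>"
  shows "I n {v\<in>\<Theta>. v \<le> t} x = p n x t"
proof -
  from confidence_measure[OF assms(1,2)] obtain Q where
    "\<And>t. t \<in> \<Theta> \<Longrightarrow> measure Q {v\<in>\<Theta>. v \<le> t} = p n x t" "\<And>A. A \<in> \<A> \<Longrightarrow> I n A x = measure Q A" by metis
  with assms(3) atMost_sets show ?thesis by simp
qed

lemma confidence_greaterThan:
  assumes "n \<ge> 1" "x \<in> \<Omega> n" "t \<in> \<Theta>"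
  shows "I n (\<Theta> - {v\<in>\<Theta>. v \<le> t}) x = lower_tail p n x t"
  using confidence_compl[OF assms(1,2) atMost_sets] confidence_atMost[OF assms]
  by (simp add: lower_tail_def)

section \<open>Convergence of the confidence in tails\<close>

text \<open>Comparing probabilities by inclusion requires measurable events, since
  \<open>measure\<close> is 0 on sets outside the \<sigma>-field.\<close>

lemma confidence_event:
  assumes "n \<ge> 1" "\<theta> \<in> \<Theta>" "\<gamma> \<in> \<Gamma>" "A \<in> \<A>"
  shows "{x \<in> space (P n \<theta> \<gamma>). I n A x > \<alpha>} \<in> sets (P n \<theta> \<gamma>)"
proof -
  have "I n A \<in> borel_measurable (P n \<theta> \<gamma>)"
    using measurable_confidence[OF assms(1,4)] measurable_cong_sets[OF sets_P[OF assms(1-3)] refl] by blast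
  then show ?thesis by measurable
qed

lemma prob_confidence_mono:
  assumes A: "A \<in> \<A>" and B: "B \<in> \<A>" and "A \<subseteq> B" and \<theta>: "\<theta> \<in> \<Theta>" "\<gamma> \<in> \<Gamma>"
    and lim: "(\<lambda>n. \<P>(x in P n \<theta> \<gamma>. I n B x > \<alpha>)) \<longlonglongrightarrow> 0"
  shows "(\<lambda>n. \<P>(x in P n \<theta> \<gamma>. I n A x > \<alpha>)) \<longlonglongrightarrow> 0"
proof (rule real_tendsto_sandwich[OF _ _ tendsto_const lim])
  show "\<forall>\<^sub>F n in sequentially. \<P>(x in P n \<theta> \<gamma>. I n A x > \<alpha>) \<le> \<P>(x in P n \<theta> \<gamma>. I n B x > \<alpha>)"
    \<comment> \<open>The model is constrained only for \<open>n \<ge> 1\<close>, so the comparison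
      can hold only eventually.\<close>
    using eventually_ge_at_top[of 1]
  proof eventually_elim
    case (elim n)
    interpret prob_space "P n \<theta> \<gamma>" using prob_space_P[OF elim \<theta>] .
    show ?case
    proof (rule finite_measure_mono[OF _ confidence_event[OF elim \<theta> B]])
      show "{x \<in> space (P n \<theta> \<gamma>). I n A x > \<alpha>} \<subseteq> {x \<in> space (P n \<theta> \<gamma>). I n B x > \<alpha>}"
        using confidence_mono[OF elim _ A B \<open>A \<subseteq> B\<close>] space_P[OF elim \<theta>] by force
    qed
  qed
qed simp

text \<open>The cut-off \<open>\<theta> - e\<close> or \<open>\<theta> + e\<close> may fall outside
  \<open>\<Theta>\<close>, where power is not assumed. Then the tail is empty and has confidence 0;
  otherwise convexity of \<open>\<Theta>\<close> supplies an admissible point at which to apply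
  \<open>powerful\<close>.\<close>

lemma prob_confidence_tail:
  assumes \<theta>: "\<theta> \<in> \<Theta>" "\<gamma> \<in> \<Gamma>" and "e > 0" and \<alpha>: "\<alpha> \<in> {0<..<1}"
  shows "(\<lambda>n. \<P>(x in P n \<theta> \<gamma>. I n {v\<in>\<Theta>. v \<le> \<theta> - e} x > \<alpha>)) \<longlonglongrightarrow> 0" (is ?left)
    and "(\<lambda>n. \<P>(x in P n \<theta> \<gamma>. I n {v\<in>\<Theta>. v \<ge> \<theta> + e} x > \<alpha>)) \<longlonglongrightarrow> 0" (is ?right)
proof -
  have empty: "(\<lambda>n. \<P>(x in P n \<theta> \<gamma>. I n {} x > \<alpha>)) \<longlonglongrightarrow> 0"
  proof (rule tendsto_eventually)
    show "\<forall>\<^sub>F n in sequentially. \<P>(x in P n \<theta> \<gamma>. I n {} x > \<alpha>) = 0"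
      using eventually_ge_at_top[of 1]
    proof eventually_elim
      case (elim n)
      have "{x \<in> space (P n \<theta> \<gamma>). I n {} x > \<alpha>} = {}"
        using confidence_empty[OF elim] space_P[OF elim \<theta>] \<alpha> by auto
      then show ?case by (simp only: measure_empty)
    qed
  qed
  show ?left
  proof (cases "{v\<in>\<Theta>. v \<le> \<theta> - e} = {}")
    case False
    \<comment> \<open>The cut-off lies between a point of the nonempty tail and
      \<open>\<theta>\<close>.\<close>
    then have a: "\<theta> - e \<in> \<Theta>"
      using mem_is_interval_1_I[OF interval, of _ \<theta> "\<theta> - e"] \<theta>(1) \<open>e > 0\<close> by auto
    have "(\<lambda>n. \<P>(x in P n \<theta> \<gamma>. p n x (\<theta> - e) > \<alpha>)) \<longlonglongrightarrow> 0"
      using powerful[unfolded asymptotically_powerful_def, rule_format, OF \<alpha> \<theta>(2,1) a] \<open>e > 0\<close> by simp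
    moreover have "\<forall>\<^sub>F n in sequentially. \<P>(x in P n \<theta> \<gamma>. p n x (\<theta> - e) > \<alpha>)
        = \<P>(x in P n \<theta> \<gamma>. I n {v\<in>\<Theta>. v \<le> \<theta> - e} x > \<alpha>)"
      using eventually_ge_at_top[of 1]
      by eventually_elim (simp add: confidence_atMost[OF _ _ a] space_P[OF _ \<theta>] cong: conj_cong)
    ultimately show ?thesis by (rule Lim_transform_eventually)
  qed (simp only: empty)
  show ?right
  proof (cases "{v\<in>\<Theta>. v \<ge> \<theta> + e} = {}")
    case False
    \<comment> \<open>The lower tail at \<open>t\<close> is the mass of the open ray
      \<open>v > t\<close>, so at \<open>\<theta> + e\<close> it would miss a possible atom at that
      endpoint. Any point strictly between \<open>\<theta>\<close> and \<open>\<theta> + e\<close>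
      avoids this; on the left the ray is closed and needs no shift.\<close>
    define b where "b = \<theta> + e / 2"
    obtain c where "c \<in> \<Theta>" "c \<ge> \<theta> + e" using False by blast
    then have b: "\<theta> < b" "b < \<theta> + e" "b \<in> \<Theta>"
      using \<open>e > 0\<close> by (auto simp: b_def intro: mem_is_interval_1_I[OF interval \<theta>(1)])
    have "(\<lambda>n. \<P>(x in P n \<theta> \<gamma>. lower_tail p n x b > \<alpha>)) \<longlonglongrightarrow> 0"
      using powerful[unfolded asymptotically_powerful_def, rule_format, OF \<alpha> \<theta>(2,1) b(3)] b(1) by simp
    moreover have "\<forall>\<^sub>F n in sequentially. \<P>(x in P n \<theta> \<gamma>. lower_tail p n x b > \<alpha>)
        = \<P>(x in P n \<theta> \<gamma>. I n (\<Theta> - {v\<in>\<Theta>. v \<le> b}) x > \<alpha>)"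
      using eventually_ge_at_top[of 1]
      by eventually_elim (simp add: confidence_greaterThan[OF _ _ b(3)] space_P[OF _ \<theta>] cong: conj_cong)
    ultimately have lim: "(\<lambda>n. \<P>(x in P n \<theta> \<gamma>. I n (\<Theta> - {v\<in>\<Theta>. v \<le> b}) x > \<alpha>)) \<longlonglongrightarrow> 0"
      by (rule Lim_transform_eventually)
    have "\<Theta> - {v\<in>\<Theta>. v \<le> b} \<in> \<A>"
      using sets.compl_sets[OF atMost_sets[of b]] by (simp add: space_restrict_space)
    moreover have "{v\<in>\<Theta>. v \<ge> \<theta> + e} \<subseteq> \<Theta> - {v\<in>\<Theta>. v \<le> b}"
      using b by auto
    ultimately show ?thesis
      by (rule prob_confidence_mono[OF atLeast_sets _ _ \<theta> lim])
  qed (simp only: empty)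
qed

text \<open>The set is covered by two tails, so by subadditivity its confidence can be large only if
  that of one of the tails is; a union bound then transfers the two limits.\<close>

lemma prob_confidence_away:
  assumes \<theta>: "\<theta> \<in> \<Theta>" "\<gamma> \<in> \<Gamma>" and B: "B \<in> \<A>" and "e > 0" and disj: "B \<inter> ball \<theta> e = {}" and "\<epsilon> > 0"
  shows "(\<lambda>n. \<P>(x in P n \<theta> \<gamma>. I n B x > \<epsilon>)) \<longlonglongrightarrow> 0"
proof -
  \<comment> \<open>Halving splits \<open>\<epsilon>\<close> between the two tails; the cap
    \<open>1 / 2\<close> keeps the level below 1, as power is assumed only for levels in the open
    unit interval while \<open>\<epsilon>\<close> is an arbitrary positive number.\<close>
  define \<alpha> where "\<alpha> = min (\<epsilon> / 2) (1 / 2)"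
  have \<alpha>: "\<alpha> \<in> {0<..<1}" "2 * \<alpha> \<le> \<epsilon>"
    using \<open>\<epsilon> > 0\<close> by (auto simp: \<alpha>_def)
  define L R where "L = {v\<in>\<Theta>. v \<le> \<theta> - e}" and "R = {v\<in>\<Theta>. v \<ge> \<theta> + e}"
  have LR: "L \<in> \<A>" "R \<in> \<A>" "L \<union> R \<in> \<A>"
    using atMost_sets atLeast_sets by (auto simp: L_def R_def simp del: ball_simps intro!: sets.Un)
  have "B \<subseteq> \<Theta>"
    using sets.sets_into_space[OF B] by (simp add: space_restrict_space)
  with disj have sub: "B \<subseteq> L \<union> R"
    by (fastforce simp: L_def R_def dist_real_def)
  have lim: "(\<lambda>n. \<P>(x in P n \<theta> \<gamma>. I n L x > \<alpha>) + \<P>(x in P n \<theta> \<gamma>. I n R x > \<alpha>)) \<longlonglongrightarrow> 0"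
    using tendsto_add[OF prob_confidence_tail[OF \<theta> \<open>e > 0\<close> \<alpha>(1)]] by (simp add: L_def R_def)
  show ?thesis
  proof (rule real_tendsto_sandwich[OF _ _ tendsto_const lim])
    show "\<forall>\<^sub>F n in sequentially. \<P>(x in P n \<theta> \<gamma>. I n B x > \<epsilon>)
        \<le> \<P>(x in P n \<theta> \<gamma>. I n L x > \<alpha>) + \<P>(x in P n \<theta> \<gamma>. I n R x > \<alpha>)"
      using eventually_ge_at_top[of 1]
    proof eventually_elim
      case (elim n)
      interpret prob_space "P n \<theta> \<gamma>" using prob_space_P[OF elim \<theta>] .
      let ?E = "\<lambda>A. {x \<in> space (P n \<theta> \<gamma>). I n A x > \<alpha>}"
      have events: "?E L \<in> events" "?E R \<in> events"
        using confidence_event[OF elim \<theta>] LR by blast+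
      \<comment> \<open>If neither tail exceeded \<open>\<alpha>\<close>, the confidence of
        \<open>B\<close> would be at most \<open>2 * \<alpha> \<le> \<epsilon>\<close>.\<close>
      have "{x \<in> space (P n \<theta> \<gamma>). I n B x > \<epsilon>} \<subseteq> ?E L \<union> ?E R"
      proof
        fix x assume "x \<in> {x \<in> space (P n \<theta> \<gamma>). I n B x > \<epsilon>}"
        then have x: "x \<in> space (P n \<theta> \<gamma>)" "x \<in> \<Omega> n" "I n B x > \<epsilon>"
          using space_P[OF elim \<theta>] by auto
        have "I n B x \<le> I n L x + I n R x"
          using confidence_mono[OF elim x(2) B LR(3) sub] confidence_Un_le[OF elim x(2) LR(1,2)] by simp
        then show "x \<in> ?E L \<union> ?E R"
          using x \<alpha>(2) by auto
      qed
      then have "prob {x \<in> space (P n \<theta> \<gamma>). I n B x > \<epsilon>} \<le> prob (?E L \<union> ?E R)"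
        using events by (intro finite_measure_mono) auto
      also have "\<dots> \<le> prob (?E L) + prob (?E R)"
        using events by (rule measure_Un_le)
      finally show ?case .
    qed
  qed simp
qed

section \<open>Consistency off the boundary\<close>

text \<open>The estimation error equals the confidence in whichever of \<open>A\<close> and
  \<open>\<Theta> - A\<close> does not contain \<open>\<theta>\<close>, and off the boundary that
  set stays at a positive distance from \<open>\<theta>\<close>.\<close>

lemma confidence_tendsto_indicator:
  assumes A: "A \<in> \<A>" and \<theta>: "\<theta> \<in> \<Theta>" "\<gamma> \<in> \<Gamma>" and frontier: "\<theta> \<notin> top_of_set \<Theta> frontier_of A"
  shows "tendsto_in_probability (\<lambda>n. P n \<theta> \<gamma>) (\<lambda>n. I n A) (indicator A \<theta>)"
proof -
  define B where "B = (if \<theta> \<in> A then \<Theta> - A else A)"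
  have "A \<subseteq> \<Theta>"
    using sets.sets_into_space[OF A] by (simp add: space_restrict_space)
  have B: "B \<in> \<A>"
    using A sets.compl_sets[OF A] by (simp add: B_def space_restrict_space)
  \<comment> \<open>The frontier is closure minus interior: a point of \<open>A\<close> lies in the
    closure, so it must be interior; a point outside \<open>A\<close> is not interior, so it must
    lie outside the closure.\<close>
  have "\<exists>T. openin (top_of_set \<Theta>) T \<and> \<theta> \<in> T \<and> T \<inter> B = {}"
  proof (cases "\<theta> \<in> A")
    case True
    then have "\<theta> \<in> top_of_set \<Theta> interior_of A"
      using frontier \<theta>(1) closure_of_subset[of A "top_of_set \<Theta>"] \<open>A \<subseteq> \<Theta>\<close>
      by (auto simp: frontier_of_def)
    then show ?thesis
      using True by (auto simp: interior_of_def B_def)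
  next
    case False
    then have "\<theta> \<notin> top_of_set \<Theta> closure_of A"
      using frontier interior_of_subset[of "top_of_set \<Theta>" A] by (auto simp: frontier_of_def)
    then show ?thesis
      using False \<theta>(1) by (auto simp: in_closure_of B_def)
  qed
  then obtain T where T: "openin (top_of_set \<Theta>) T" "\<theta> \<in> T" "T \<inter> B = {}" by blast
  \<comment> \<open>Relative openness controls the ball only inside \<open>\<Theta>\<close>, which
    is enough because \<open>B\<close> is contained in \<open>\<Theta>\<close>.\<close>
  then obtain e where e: "e > 0" "ball \<theta> e \<inter> \<Theta> \<subseteq> T"
    by (meson openin_contains_ball)
  have "B \<inter> ball \<theta> e = {}"
    using T e sets.sets_into_space[OF B] by (auto simp: space_restrict_space)
  note away = prob_confidence_away[OF \<theta> B e(1) this]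
  \<comment> \<open>For \<open>\<theta>\<close> in \<open>A\<close> the error is
    \<open>1 - I n A x\<close>, the confidence in the complement; otherwise it is
    \<open>I n A x\<close> itself.\<close>
  have error: "\<bar>I n A x - indicator A \<theta>\<bar> = I n B x" if "n \<ge> 1" "x \<in> \<Omega> n" for n x
    using confidence_nonneg[OF that A] confidence_nonneg[OF that B] confidence_compl[OF that A]
    by (auto simp: B_def)
  show ?thesis
    unfolding tendsto_in_probability_def
  proof (intro allI impI)
    fix \<epsilon> :: real assume "\<epsilon> > 0"
    have "\<forall>\<^sub>F n in sequentially.
        \<P>(x in P n \<theta> \<gamma>. I n B x > \<epsilon>) = \<P>(x in P n \<theta> \<gamma>. \<bar>I n A x - indicator A \<theta>\<bar> > \<epsilon>)"
      using eventually_ge_at_top[of 1]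
      by eventually_elim (simp add: error space_P[OF _ \<theta>] cong: conj_cong)
    then show "(\<lambda>n. \<P>(x in P n \<theta> \<gamma>. \<bar>I n A x - indicator A \<theta>\<bar> > \<epsilon>)) \<longlonglongrightarrow> 0"
      by (rule Lim_transform_eventually[OF away[OF \<open>\<epsilon> > 0\<close>]])
  qed
qed

end

theorem proposition20:
  fixes \<Omega> :: "nat \<Rightarrow> (nat \<Rightarrow> real) set"
    and \<Theta> :: "real set"
    and \<Gamma> :: "'g set"
    and P :: "nat \<Rightarrow> real \<Rightarrow> 'g \<Rightarrow> (nat \<Rightarrow> real) measure"
    and p :: "nat \<Rightarrow> (nat \<Rightarrow> real) \<Rightarrow> real \<Rightarrow> real"
    and I :: "nat \<Rightarrow> real set \<Rightarrow> (nat \<Rightarrow> real) \<Rightarrow> real"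
  assumes "statistical_model \<Omega> \<Theta> \<Gamma> P"
    and "upper_tail_p_value_function \<Omega> \<Theta> \<Gamma> P p"
    and "asymptotically_powerful \<Theta> \<Gamma> P p"
    and "\<And>n x. n \<ge> 1 \<Longrightarrow> x \<in> \<Omega> n \<Longrightarrow> is_confidence_measure \<Theta> (p n x) (\<lambda>A. I n A x)"
  shows "consistent_indicator_estimator \<Omega> \<Theta> \<Gamma> P I"
proof -
  interpret confidence_model \<Omega> \<Theta> \<Gamma> P p I
    using assms by (intro confidence_model.intro confidence_model_axioms.intro)
  show ?thesis
    unfolding consistent_indicator_estimator_def
    using measurable_confidence confidence_tendsto_indicator by blast
qed

end
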